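(* Let $X\subseteq\mathbb{R}^n$ be a nonempty closed convex set, let $\|\cdot\|$ be an arbitrary (but fixed) norm on $\mathbb{R}^n$, let $f:X\to\mathbb{R}$ be a differentiable convex function that is $L$-smooth with respect to $\|\cdot\|$ ($L>0$), and let $\mathbf{x}^*\in X$ be a minimizer of $f$ over $X$. Let $\psi:X\to\mathbb{R}$ be continuously differentiable and $\sigma$-strongly convex with respect to $\|\cdot\|$ ($\sigma>0$). Let $(a_k)_{k\ge1}$ be positive reals, $A_0=0$ and $A_k=\sum_{i=1}^k a_i$. Let $\mathbf{x}^{(k)},\mathbf{z}^{(k)},\hat{\mathbf{x}}^{(k)},\hat{\mathbf{z}}^{(k)}$ be updated according to the AXGD algorithm, starting from an arbitrary initial point $\hat{\mathbf{x}}^{(0)}\in X$ with $\mathbf{z}^{(0)}=\nabla\psi(\hat{\mathbf{x}}^{(0)})$ and $A_0=0$. If $$\frac{a_k^2}{A_k}\le\frac{\sigma}{L}\quad\text{for all }k\ge1,$$ then for all $k\ge1$, $$f(\mathbf{x}^{(k)})-f(\mathbf{x}^* )\le\frac{D_\psi(\mathbf{x}^*,\hat{\mathbf{x}}^{(0)})}{A_k}.$$ In particular, if $a_k=\frac{k+1}{2}\cdot\frac{\sigma}{L}$ for all $k\ge1$ and $\psi(\mathbf{x})=\frac{\sigma}{2}\|\mathbf{x}\|^2$, then for all $k\ge1$, $$f(\mathbf{x}^{(k)})-f(\mathbf{x}^* )\le\frac{2L}{(k+1)^2}\|\mathbf{x}^*-\hat{\mathbf{x}}^{(0)}\|^2.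$$
   Context: $\langle\cdot,\cdot\rangle$ is the standard pairing on $\mathbb{R}^n$, and $\|\mathbf{z}\|_*=\sup\{\langle\mathbf{z},\mathbf{x}\rangle:\|\mathbf{x}\|=1\}$ is the dual norm. $\nabla$ denotes the gradient. $f$ is convex on $X$ if $f(\hat{\mathbf{x}})\ge f(\mathbf{x})+\langle\nabla f(\mathbf{x}),\hat{\mathbf{x}}-\mathbf{x}\rangle$ for all $\mathbf{x},\hat{\mathbf{x}}\in X$. $f$ is $L$-smooth if $\|\nabla f(\mathbf{x})-\nabla f(\hat{\mathbf{x}})\|_*\le L\|\mathbf{x}-\hat{\mathbf{x}}\|$ for all $\mathbf{x},\hat{\mathbf{x}}\in X$. $\psi$ is $\sigma$-strongly convex if $\psi(\hat{\mathbf{x}})\ge\psi(\mathbf{x})+\langle\nabla\psi(\mathbf{x}),\hat{\mathbf{x}}-\mathbf{x}\rangle+\frac{\sigma}{2}\|\hat{\mathbf{x}}-\mathbf{x}\|^2$ for all $\mathbf{x},\hat{\mathbf{x}}\in X$. The Bregman divergence is $D_\psi(\mathbf{x},\hat{\mathbf{x}})=\psi(\mathbf{x})-\psi(\hat{\mathbf{x}})-\langle\nabla\psi(\hat{\mathbf{x}}),\mathbf{x}-\hat{\mathbf{x}}\rangle$. The convex conjugate is $\psi^*(\mathbf{z})=\max_{\mathbf{x}\in X}\{\langle\mathbf{z},\mathbf{x}\rangle-\psi(\mathbf{x})\}$ for $\mathbf{z}\in\mathbb{R}^n$; it satisfies $\nabla\psi^*(\mathbf{z})=\arg\max_{\mathbf{x}\in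 X}\{\langle\mathbf{z},\mathbf{x}\rangle-\psi(\mathbf{x})\}\in X$. AXGD (Accelerated Extra-Gradient Descent): for $k=0,1,2,\dots$, $$\hat{\mathbf{x}}^{(k)}=\tfrac{A_k}{A_{k+1}}\mathbf{x}^{(k)}+\tfrac{a_{k+1}}{A_{k+1}}\nabla\psi^*(\mathbf{z}^{(k)}),\qquad \hat{\mathbf{z}}^{(k)}=\mathbf{z}^{(k)}-a_{k+1}\nabla f(\hat{\mathbf{x}}^{(k)}),$$ $$\mathbf{x}^{(k+1)}=\tfrac{A_k}{A_{k+1}}\mathbf{x}^{(k)}+\tfrac{a_{k+1}}{A_{k+1}}\nabla\psi^*(\hat{\mathbf{z}}^{(k)}),\qquad \mathbf{z}^{(k+1)}=\mathbf{z}^{(k)}-a_{k+1}\nabla f(\mathbf{x}^{(k+1)}).$$ For $k=0$ the terms with $\mathbf{x}^{(0)}$ have coefficient $A_0/A_1=0$ and are absent, and the first formula is consistent with the given $\hat{\mathbf{x}}^{(0)}$ since $\nabla\psi^*(\nabla\psi(\hat{\mathbf{x}}^{(0)}))=\hat{\mathbf{x}}^{(0)}$.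
   Formalization: In the "in particular" part, (σ/2)‖·‖² is assumed continuously differentiable and σ-strongly convex on all of R^n, not only on X (so ‖·‖ comes from an inner product); without this the final bound can fail when X is a proper subset. *)

theory Defs
  imports "HOL-Analysis.Analysis"
begin

definition is_norm :: "(real ^ 'n \<Rightarrow> real) \<Rightarrow> bool" where
  "is_norm N \<longleftrightarrow>
     (\<forall>x. N x = 0 \<longleftrightarrow> x = 0) \<and>
     (\<forall>c x. N (c *\<^sub>R x) = \<bar>c\<bar> * N x) \<and>
     (\<forall>x y. N (x + y) \<le> N x + N y)"

definition dual_norm :: "(real ^ 'n \<Rightarrow> real) \<Rightarrow> real ^ 'n \<Rightarrow> real" where
  "dual_norm N z = (SUP x\<in>{x. N x = 1}. z \<bullet> x)"

text \<open>
  A function on a convex set \<open>X\<close> is modelled by a total function whose values outside \<open>X\<close> are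
  irrelevant, so differentiability is taken within \<open>X\<close>. The gradient field \<open>g\<close> is an explicit
  argument: it is determined by \<open>f\<close> on \<open>X\<close> if \<open>X\<close> has nonempty interior, but only up to vectors
  orthogonal to \<open>X\<close> otherwise (everything if \<open>X\<close> is a single point).
\<close>
definition has_gradient_on ::
    "(real ^ 'n) set \<Rightarrow> (real ^ 'n \<Rightarrow> real) \<Rightarrow> (real ^ 'n \<Rightarrow> real ^ 'n) \<Rightarrow> bool" where
  "has_gradient_on X f g \<longleftrightarrow> (\<forall>x\<in>X. (f has_derivative (\<lambda>h. g x \<bullet> h)) (at x within X))"

definition grad_convex_on ::
    "(real ^ 'n) set \<Rightarrow> (real ^ 'n \<Rightarrow> real) \<Rightarrow> (real ^ 'n \<Rightarrow> real ^ 'n) \<Rightarrow> bool" where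
  "grad_convex_on X f g \<longleftrightarrow> (\<forall>x\<in>X. \<forall>y\<in>X. f y \<ge> f x + g x \<bullet> (y - x))"

definition smooth_wrt ::
    "(real ^ 'n) set \<Rightarrow> (real ^ 'n \<Rightarrow> real) \<Rightarrow> real \<Rightarrow> (real ^ 'n \<Rightarrow> real ^ 'n) \<Rightarrow> bool" where
  "smooth_wrt X N L g \<longleftrightarrow> (\<forall>x\<in>X. \<forall>y\<in>X. dual_norm N (g x - g y) \<le> L * N (x - y))"

definition strongly_convex_wrt ::
    "(real ^ 'n) set \<Rightarrow> (real ^ 'n \<Rightarrow> real) \<Rightarrow> real \<Rightarrow> (real ^ 'n \<Rightarrow> real) \<Rightarrow>
     (real ^ 'n \<Rightarrow> real ^ 'n) \<Rightarrow> bool" where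
  "strongly_convex_wrt X N \<sigma> \<psi> g \<longleftrightarrow>
     (\<forall>x\<in>X. \<forall>y\<in>X. \<psi> y \<ge> \<psi> x + g x \<bullet> (y - x) + \<sigma> / 2 * (N (y - x))\<^sup>2)"

text \<open>
  The function \<open>\<sigma> / 2 * (N y)\<^sup>2\<close> is a regularizer on \<open>UNIV\<close> exactly if \<open>N\<close> is induced by an inner product.
  On a proper subset \<open>X\<close> it can be one for other norms; its Bregman divergence may then exceed
  \<open>\<sigma> / 2 * (N (x - y))\<^sup>2\<close>.
\<close>
definition regularizer ::
    "(real ^ 'n) set \<Rightarrow> (real ^ 'n \<Rightarrow> real) \<Rightarrow> real \<Rightarrow> (real ^ 'n \<Rightarrow> real) \<Rightarrow>
     (real ^ 'n \<Rightarrow> real ^ 'n) \<Rightarrow> bool" where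
  "regularizer X N \<sigma> \<psi> g \<longleftrightarrow>
     has_gradient_on X \<psi> g \<and> continuous_on X g \<and> strongly_convex_wrt X N \<sigma> \<psi> g"

definition bregman ::
    "(real ^ 'n \<Rightarrow> real) \<Rightarrow> (real ^ 'n \<Rightarrow> real ^ 'n) \<Rightarrow> real ^ 'n \<Rightarrow> real ^ 'n \<Rightarrow> real" where
  "bregman \<psi> g x y = \<psi> x - \<psi> y - g y \<bullet> (x - y)"

text \<open>
  For \<open>X\<close> nonempty and closed and \<open>\<psi>\<close> continuous and strongly convex on \<open>X\<close>, the supremum is finite
  and attained, at a unique point.
\<close>
definition conjugate_on :: "(real ^ 'n) set \<Rightarrow> (real ^ 'n \<Rightarrow> real) \<Rightarrow> real ^ 'n \<Rightarrow> real" where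
  "conjugate_on X \<psi> z = (SUP x\<in>X. z \<bullet> x - \<psi> x)"

definition grad :: "(real ^ 'n \<Rightarrow> real) \<Rightarrow> real ^ 'n \<Rightarrow> real ^ 'n" where
  "grad F z = (THE g. GDERIV F z :> g)"

definition psum :: "(nat \<Rightarrow> real) \<Rightarrow> nat \<Rightarrow> real" where
  "psum a k = (\<Sum>i=1..k. a i)"

text \<open>
  The vector \<open>x 0\<close> is an unconstrained dummy: it only occurs with the coefficient
  \<open>psum a 0 / psum a 1 = 0\<close>.
\<close>
definition axgd ::
    "(real ^ 'n) set \<Rightarrow> (real ^ 'n \<Rightarrow> real ^ 'n) \<Rightarrow> (real ^ 'n \<Rightarrow> real) \<Rightarrow> (nat \<Rightarrow> real) \<Rightarrow>
     (nat \<Rightarrow> real ^ 'n) \<Rightarrow> (nat \<Rightarrow> real ^ 'n) \<Rightarrow> (nat \<Rightarrow> real ^ 'n) \<Rightarrow> (nat \<Rightarrow> real ^ 'n) \<Rightarrow> bool" where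
  "axgd X gf \<psi> a x z xh zh \<longleftrightarrow>
     (\<forall>k.
       xh k = (psum a k / psum a (k + 1)) *\<^sub>R x k
              + (a (k + 1) / psum a (k + 1)) *\<^sub>R grad (conjugate_on X \<psi>) (z k) \<and>
       zh k = z k - a (k + 1) *\<^sub>R gf (xh k) \<and>
       x (k + 1) = (psum a k / psum a (k + 1)) *\<^sub>R x k
              + (a (k + 1) / psum a (k + 1)) *\<^sub>R grad (conjugate_on X \<psi>) (zh k) \<and>
       z (k + 1) = z k - a (k + 1) *\<^sub>R gf (x (k + 1)))"

end

theory Submission
  imports Defs
begin

text \<open>
  The map \<open>\<nabla>\<psi>*\<close> sends \<open>z\<close> to the maximizer \<open>p\<close> of \<open>z \<bullet> y - \<psi> y\<close>, and this objective falls off at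
  least like \<open>\<sigma> / 2 * (N (y - p))\<^sup>2\<close>. The quantity
  \<open>A\<^sub>k f(x\<^sub>k) - (\<Sum>i\<le>k. a\<^sub>i (f(x\<^sub>i) - \<nabla>f(x\<^sub>i) \<bullet> x\<^sub>i)) + \<psi>*(z\<^sub>k)\<close> does not increase along the
  iteration: the error term \<open>a (\<nabla>f(x\<^sub>k\<^sub>+\<^sub>1) - \<nabla>f(xh\<^sub>k)) \<bullet> (\<nabla>\<psi>*(zh\<^sub>k) - \<nabla>\<psi>*(z\<^sub>k\<^sub>+\<^sub>1))\<close> of a step is bounded
  through smoothness and the step size condition by the quadratic growth at \<open>z\<^sub>k\<close> and \<open>zh\<^sub>k\<close>. Convexity
  of \<open>f\<close> and the Fenchel-Young inequality at the minimizer bound the potential from below.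
\<close>

section \<open>Arbitrary norms on a Euclidean space and their duals\<close>

lemma is_norm_scaleR: "is_norm N \<Longrightarrow> N (c *\<^sub>R x) = \<bar>c\<bar> * N x"
  by (simp add: is_norm_def)

lemma is_norm_zero_iff: "is_norm N \<Longrightarrow> N x = 0 \<longleftrightarrow> x = 0"
  by (simp add: is_norm_def)

lemma is_norm_triangle: "is_norm N \<Longrightarrow> N (x + y) \<le> N x + N y"
  by (simp add: is_norm_def)

lemma is_norm_nonneg:
  assumes "is_norm N" shows "0 \<le> N x"
  using is_norm_triangle[OF assms, of x "- x"] is_norm_scaleR[OF assms, of "-1" x]
    is_norm_scaleR[OF assms, of 0 x] by simp

lemma is_norm_minus_commute:
  assumes "is_norm N" shows "N (x - y) = N (y - x)"
  using is_norm_scaleR[OF assms, of "-1" "x - y"] by simp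

text \<open>Homogeneity and the triangle inequality make \<open>N\<close> convex, and a real-valued
  convex function on a finite-dimensional space is continuous.\<close>

lemma is_norm_continuous_on:
  fixes N :: "real ^ 'n \<Rightarrow> real"
  assumes "is_norm N" shows "continuous_on UNIV N"
proof (rule convex_on_continuous)
  show "convex_on UNIV N"
  proof (rule convex_onI)
    fix t :: real and x y :: "real ^ 'n"
    assume "0 < t" "t < 1"
    have "N ((1 - t) *\<^sub>R x + t *\<^sub>R y) \<le> N ((1 - t) *\<^sub>R x) + N (t *\<^sub>R y)"
      by (rule is_norm_triangle[OF assms])
    then show "N ((1 - t) *\<^sub>R x + t *\<^sub>R y) \<le> (1 - t) * N x + t * N y"
      using \<open>0 < t\<close> \<open>t < 1\<close> by (simp add: is_norm_scaleR[OF assms])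
  qed simp
qed simp

text \<open>On the compact Euclidean unit sphere \<open>N\<close> attains a minimum, which is
  positive by definiteness; homogeneity does the rest.\<close>

lemma is_norm_lower_bound:
  fixes N :: "real ^ 'n \<Rightarrow> real"
  assumes "is_norm N"
  obtains c where "c > 0" "\<And>x. c * norm x \<le> N x"
proof -
  have "compact (sphere (0 :: real ^ 'n) 1)" "sphere (0 :: real ^ 'n) 1 \<noteq> {}"
    by simp_all
  then obtain u :: "real ^ 'n" where u: "u \<in> sphere 0 1" "\<And>y. y \<in> sphere 0 1 \<Longrightarrow> N u \<le> N y"
    using continuous_attains_inf[OF _ _ continuous_on_subset[OF is_norm_continuous_on[OF assms] subset_UNIV]]
    by metis
  show ?thesis
  proof
    have "u \<noteq> 0" using u(1) by auto
    then show "N u > 0"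
      using is_norm_nonneg[OF assms, of u] is_norm_zero_iff[OF assms, of u] by simp
    fix x :: "real ^ 'n"
    show "N u * norm x \<le> N x"
    proof (cases "x = 0")
      case True
      then show ?thesis using is_norm_nonneg[OF assms] by simp
    next
      case False
      then have "N u \<le> N ((1 / norm x) *\<^sub>R x)"
        by (intro u(2)) simp
      with False show ?thesis
        by (simp add: is_norm_scaleR[OF assms] field_simps)
    qed
  qed
qed

text \<open>Normalizing \<open>x\<close> gives a competitor in the supremum. A real supremum bounds
  its competitors only if the set is bounded above, which holds because the unit sphere of
  \<open>N\<close> is bounded in the Euclidean norm.\<close>

lemma inner_le_dual_norm:
  fixes N :: "real ^ 'n \<Rightarrow> real"
  assumes "is_norm N"
  shows "z \<bullet> x \<le> dual_norm N z * N x"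
proof (cases "x = 0")
  case True
  then show ?thesis using is_norm_zero_iff[OF assms, of x] by simp
next
  case False
  then have pos: "N x > 0"
    using is_norm_nonneg[OF assms, of x] is_norm_zero_iff[OF assms, of x] by simp
  obtain c where c: "c > 0" "\<And>x. c * norm x \<le> N x"
    using is_norm_lower_bound[OF assms] by blast
  have "bdd_above ((\<lambda>x. z \<bullet> x) ` {x. N x = 1})"
  proof (rule bdd_aboveI2)
    fix y assume "y \<in> {x. N x = 1}"
    then have "norm y \<le> 1 / c"
      using c(1) c(2)[of y] by (simp add: field_simps)
    then have "norm z * norm y \<le> norm z * (1 / c)"
      by (rule mult_left_mono) simp
    then show "z \<bullet> y \<le> norm z * (1 / c)"
      using norm_cauchy_schwarz[of z y] by linarith
  qed
  moreover have "(1 / N x) *\<^sub>R x \<in> {x. N x = 1}"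
    using pos by (simp add: is_norm_scaleR[OF assms])
  ultimately have "z \<bullet> ((1 / N x) *\<^sub>R x) \<le> dual_norm N z"
    unfolding dual_norm_def by (intro cSUP_upper)
  then show ?thesis using pos by (simp add: field_simps)
qed

section \<open>Strong convexity, maximizers and the gradient of the conjugate\<close>

text \<open>Strong convexity at the intermediate point \<open>m\<close>, tested at \<open>x\<close>
  and \<open>y\<close> and averaged with weights \<open>1 - t\<close> and \<open>t\<close>: the
  gradient terms cancel, and the quadratic terms add up to the factor
  \<open>t * (1 - t)\<close>.\<close>

lemma strongly_convex_wrt_Jensen:
  assumes N: "is_norm N" and sc: "strongly_convex_wrt X N \<sigma> \<psi> g" and "convex X"
    and x: "x \<in> X" and y: "y \<in> X" and t: "0 \<le> t" "t \<le> 1"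
  shows "\<psi> ((1 - t) *\<^sub>R x + t *\<^sub>R y)
      \<le> (1 - t) * \<psi> x + t * \<psi> y - \<sigma> / 2 * (t * (1 - t)) * (N (y - x))\<^sup>2"
proof -
  define m where "m = (1 - t) *\<^sub>R x + t *\<^sub>R y"
  have m: "m \<in> X"
    using \<open>convex X\<close> x y t by (auto simp: m_def convex_def)
  have xm: "x - m = (- t) *\<^sub>R (y - x)" and ym: "y - m = (1 - t) *\<^sub>R (y - x)"
    by (simp_all add: m_def algebra_simps)
  have "\<psi> m + g m \<bullet> (x - m) + \<sigma> / 2 * (N (x - m))\<^sup>2 \<le> \<psi> x"
    and "\<psi> m + g m \<bullet> (y - m) + \<sigma> / 2 * (N (y - m))\<^sup>2 \<le> \<psi> y"
    using sc m x y by (auto simp: strongly_convex_wrt_def)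
  then have "(1 - t) * (\<psi> m - t * (g m \<bullet> (y - x)) + \<sigma> / 2 * (t\<^sup>2 * (N (y - x))\<^sup>2)) \<le> (1 - t) * \<psi> x"
    and "t * (\<psi> m + (1 - t) * (g m \<bullet> (y - x)) + \<sigma> / 2 * ((1 - t)\<^sup>2 * (N (y - x))\<^sup>2)) \<le> t * \<psi> y"
    using t unfolding xm ym is_norm_scaleR[OF N] inner_scaleR_right
    by (intro mult_left_mono; simp add: power_mult_distrib)+
  moreover have "(1 - t) * (p - t * q + \<sigma> / 2 * (t\<^sup>2 * r)) + t * (p + (1 - t) * q + \<sigma> / 2 * ((1 - t)\<^sup>2 * r))
      = p + \<sigma> / 2 * (t * (1 - t)) * r" for p q r
    by (simp add: field_simps power2_eq_square)
  ultimately have "\<psi> m + \<sigma> / 2 * (t * (1 - t)) * (N (y - x))\<^sup>2 \<le> (1 - t) * \<psi> x + t * \<psi> y"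
    by (metis add_mono)
  then show ?thesis by (simp add: m_def)
qed

definition conjugate_argmax ::
    "(real ^ 'n) set \<Rightarrow> (real ^ 'n \<Rightarrow> real) \<Rightarrow> real ^ 'n \<Rightarrow> real ^ 'n \<Rightarrow> bool" where
  "conjugate_argmax X \<psi> z p \<longleftrightarrow> p \<in> X \<and> (\<forall>y\<in>X. z \<bullet> y - \<psi> y \<le> z \<bullet> p - \<psi> p)"

text \<open>Comparing \<open>p\<close> with a point at parameter \<open>t\<close> on the segment to
  \<open>y\<close> and dividing by \<open>t\<close> gives the bound with the factor
  \<open>1 - t\<close>; then \<open>t\<close> tends to 0 from the right.\<close>

lemma conjugate_argmax_growth:
  assumes N: "is_norm N" and sc: "strongly_convex_wrt X N \<sigma> \<psi> g" and "convex X"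
    and p: "conjugate_argmax X \<psi> z p" and y: "y \<in> X"
  shows "z \<bullet> y - \<psi> y + \<sigma> / 2 * (N (y - p))\<^sup>2 \<le> z \<bullet> p - \<psi> p"
proof (rule tendsto_upperbound)
  show "((\<lambda>t. z \<bullet> y - \<psi> y + \<sigma> / 2 * (1 - t) * (N (y - p))\<^sup>2) \<longlongrightarrow>
      z \<bullet> y - \<psi> y + \<sigma> / 2 * (N (y - p))\<^sup>2) (at_right 0)"
    by (auto intro!: tendsto_eq_intros)
  have "z \<bullet> y - \<psi> y + \<sigma> / 2 * (1 - t) * (N (y - p))\<^sup>2 \<le> z \<bullet> p - \<psi> p"
    if t: "0 < t" "t < 1" for t
  proof -
    define m where "m = (1 - t) *\<^sub>R p + t *\<^sub>R y"
    have pX: "p \<in> X" using p by (simp add: conjugate_argmax_def)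
    then have "m \<in> X"
      using \<open>convex X\<close> y t by (auto simp: m_def convex_def)
    then have "z \<bullet> m - \<psi> m \<le> z \<bullet> p - \<psi> p"
      using p by (simp add: conjugate_argmax_def)
    moreover have "\<psi> m \<le> (1 - t) * \<psi> p + t * \<psi> y - \<sigma> / 2 * (t * (1 - t)) * (N (y - p))\<^sup>2"
      unfolding m_def using strongly_convex_wrt_Jensen[OF N sc \<open>convex X\<close> pX y] t by simp
    moreover have "z \<bullet> m = (1 - t) * (z \<bullet> p) + t * (z \<bullet> y)"
      by (simp add: m_def inner_add_right)
    ultimately have "t * (z \<bullet> y - \<psi> y + \<sigma> / 2 * (1 - t) * (N (y - p))\<^sup>2) \<le> t * (z \<bullet> p - \<psi> p)"
      by (simp add: algebra_simps)
    with t show ?thesis by simp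
  qed
  then show "\<forall>\<^sub>F t in at_right 0. z \<bullet> y - \<psi> y + \<sigma> / 2 * (1 - t) * (N (y - p))\<^sup>2 \<le> z \<bullet> p - \<psi> p"
    using eventually_at_right_less[of "0::real"] unfolding eventually_at_right_field
    by (intro exI[of _ 1]) auto
qed simp

text \<open>Outside a ball around some \<open>w\<close> in \<open>X\<close> the objective does not
  exceed its value at \<open>w\<close>, so a maximizer over the compact part of \<open>X\<close>
  inside the ball is global.\<close>

lemma conjugate_argmax_exists:
  fixes X :: "(real ^ 'n) set"
  assumes N: "is_norm N" and sc: "strongly_convex_wrt X N \<sigma> \<psi> g" and "\<sigma> > 0"
    and "X \<noteq> {}" "closed X" and cont: "continuous_on X \<psi>"
  obtains p where "conjugate_argmax X \<psi> z p"
proof -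
  obtain c where c: "c > 0" "\<And>x. c * norm x \<le> N x"
    using is_norm_lower_bound[OF N] by blast
  obtain w where w: "w \<in> X" using \<open>X \<noteq> {}\<close> by blast
  \<comment> \<open>Beyond this radius the quadratic term of strong convexity at \<open>w\<close>
    dominates the linear term with slope \<open>z - g w\<close>.\<close>
  define r where "r = norm (z - g w) / (\<sigma> / 2 * c\<^sup>2)"
  have r: "r \<ge> 0" using c(1) \<open>\<sigma> > 0\<close> by (simp add: r_def)
  have far: "z \<bullet> y - \<psi> y \<le> z \<bullet> w - \<psi> w" if y: "y \<in> X" "r < norm (y - w)" for y
  proof -
    have "(c * norm (y - w))\<^sup>2 \<le> (N (y - w))\<^sup>2"
      using c by (intro power_mono) auto
    then have "\<sigma> / 2 * (c * norm (y - w))\<^sup>2 \<le> \<sigma> / 2 * (N (y - w))\<^sup>2"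
      using \<open>\<sigma> > 0\<close> by simp
    moreover have "\<psi> w + g w \<bullet> (y - w) + \<sigma> / 2 * (N (y - w))\<^sup>2 \<le> \<psi> y"
      using sc w y by (auto simp: strongly_convex_wrt_def)
    moreover have "(z - g w) \<bullet> (y - w) \<le> norm (z - g w) * norm (y - w)"
      by (rule norm_cauchy_schwarz)
    moreover have "norm (z - g w) \<le> \<sigma> / 2 * c\<^sup>2 * norm (y - w)"
      using y(2) c(1) \<open>\<sigma> > 0\<close> by (simp add: r_def field_simps)
    then have "norm (z - g w) * norm (y - w) \<le> \<sigma> / 2 * c\<^sup>2 * norm (y - w) * norm (y - w)"
      by (rule mult_right_mono) simp
    ultimately show ?thesis
      by (simp add: inner_diff_left inner_diff_right power_mult_distrib power2_eq_square algebra_simps)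
  qed
  have "compact (X \<inter> cball w r)" "X \<inter> cball w r \<noteq> {}"
    using \<open>closed X\<close> w r by (auto intro!: closed_Int_compact)
  moreover have "continuous_on (X \<inter> cball w r) (\<lambda>y. z \<bullet> y - \<psi> y)"
    by (intro continuous_intros continuous_on_subset[OF cont]) auto
  ultimately obtain p where p: "p \<in> X \<inter> cball w r"
    "\<And>y. y \<in> X \<inter> cball w r \<Longrightarrow> z \<bullet> y - \<psi> y \<le> z \<bullet> p - \<psi> p"
    using continuous_attains_sup[of "X \<inter> cball w r" "\<lambda>y. z \<bullet> y - \<psi> y"] by blast
  have "z \<bullet> y - \<psi> y \<le> z \<bullet> p - \<psi> p" if "y \<in> X" for y
  proof (cases "y \<in> cball w r")
    case True
    then show ?thesis using p(2) that by simp
  next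
    case False
    then have "z \<bullet> y - \<psi> y \<le> z \<bullet> w - \<psi> w"
      by (intro far that) (simp add: dist_norm norm_minus_commute)
    also have "\<dots> \<le> z \<bullet> p - \<psi> p"
      using w r by (intro p(2)) simp
    finally show ?thesis .
  qed
  then show ?thesis using p(1) by (intro that) (auto simp: conjugate_argmax_def)
qed

lemma conjugate_on_eq:
  assumes "conjugate_argmax X \<psi> z p"
  shows "conjugate_on X \<psi> z = z \<bullet> p - \<psi> p"
  unfolding conjugate_on_def
  using assms by (intro cSup_eq_maximum) (auto simp: conjugate_argmax_def)

text \<open>Linearizing the conjugate at \<open>z\<close> with slope \<open>p\<close> leaves a
  remainder quadratic in \<open>w - z\<close>. Uniqueness of derivatives then evaluates the definite
  description in \<open>grad\<close>.\<close>

lemma grad_conjugate_on: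
  fixes X :: "(real ^ 'n) set"
  assumes N: "is_norm N" and sc: "strongly_convex_wrt X N \<sigma> \<psi> g" and "\<sigma> > 0"
    and "convex X" "closed X" and cont: "continuous_on X \<psi>"
    and p: "conjugate_argmax X \<psi> z p"
  shows "grad (conjugate_on X \<psi>) z = p"
proof -
  let ?F = "conjugate_on X \<psi>"
  obtain c where c: "c > 0" "\<And>x. c * norm x \<le> N x"
    using is_norm_lower_bound[OF N] by blast
  define K where "K = 1 / (\<sigma> * c\<^sup>2)"
  have K: "K > 0" using \<open>\<sigma> > 0\<close> c(1) by (simp add: K_def)
  have pX: "p \<in> X" using p by (simp add: conjugate_argmax_def)
  \<comment> \<open>The remainder lies between 0 and \<open>(w - z) \<bullet> (q - p)\<close>, where \<open>q\<close> is the maximizer for \<open>w\<close>,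
    and maximizers depend Lipschitz continuously on the dual variable.\<close>
  have rem: "\<bar>?F w - ?F z - p \<bullet> (w - z)\<bar> \<le> K * (norm (w - z))\<^sup>2" for w
  proof -
    obtain q where q: "conjugate_argmax X \<psi> w q"
      using conjugate_argmax_exists[OF N sc \<open>\<sigma> > 0\<close> _ \<open>closed X\<close> cont, of w] pX by blast
    then have qX: "q \<in> X" by (simp add: conjugate_argmax_def)
    have 1: "z \<bullet> q - \<psi> q + \<sigma> / 2 * (N (q - p))\<^sup>2 \<le> z \<bullet> p - \<psi> p"
      by (rule conjugate_argmax_growth[OF N sc \<open>convex X\<close> p qX])
    have 2: "w \<bullet> p - \<psi> p + \<sigma> / 2 * (N (q - p))\<^sup>2 \<le> w \<bullet> q - \<psi> q"
      using conjugate_argmax_growth[OF N sc \<open>convex X\<close> q pX] is_norm_minus_commute[OF N, of p q]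
      by simp
    have "(c * norm (q - p))\<^sup>2 \<le> (N (q - p))\<^sup>2"
      using c by (intro power_mono) auto
    then have "\<sigma> * (c * norm (q - p))\<^sup>2 \<le> \<sigma> * (N (q - p))\<^sup>2"
      using \<open>\<sigma> > 0\<close> by simp
    \<comment> \<open>The sum of the two growth inequalities, in which the values of \<psi>
      cancel.\<close>
    also have "\<dots> \<le> (w - z) \<bullet> (q - p)"
      using 1 2 by (simp add: inner_diff_left inner_diff_right)
    also have 3: "(w - z) \<bullet> (q - p) \<le> norm (w - z) * norm (q - p)"
      by (rule norm_cauchy_schwarz)
    finally have "norm (q - p) * (\<sigma> * c\<^sup>2 * norm (q - p)) \<le> norm (q - p) * norm (w - z)"
      by (simp add: power_mult_distrib power2_eq_square mult_ac)
    then have "q = p \<or> \<sigma> * c\<^sup>2 * norm (q - p) \<le> norm (w - z)"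
      by (auto simp: mult_le_cancel_left)
    then have "norm (q - p) \<le> K * norm (w - z)"
      using c(1) \<open>\<sigma> > 0\<close> by (auto simp: K_def field_simps)
    then have "norm (w - z) * norm (q - p) \<le> norm (w - z) * (K * norm (w - z))"
      by (rule mult_left_mono) simp
    then have 4: "(w - z) \<bullet> (q - p) \<le> K * (norm (w - z))\<^sup>2"
      using 3 by (simp add: power2_eq_square mult_ac)
    have "0 \<le> \<sigma> / 2 * (N (q - p))\<^sup>2" using \<open>\<sigma> > 0\<close> by simp
    then show ?thesis
      using 1 2 4 unfolding conjugate_on_eq[OF p] conjugate_on_eq[OF q]
      by (simp add: inner_diff_left inner_diff_right inner_commute abs_le_iff)
  qed
  have der: "GDERIV ?F z :> p"
    unfolding gderiv_def has_derivative_within_alt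
  proof (intro conjI allI impI)
    show "bounded_linear (\<lambda>h. h \<bullet> p)" by (rule bounded_linear_inner_left)
    fix e :: real assume "e > 0"
    have "norm (?F w - ?F z - (w - z) \<bullet> p) \<le> e * norm (w - z)" if "norm (w - z) < e / K" for w
    proof -
      have "K * norm (w - z) \<le> e" using that K by (simp add: field_simps)
      then have "K * norm (w - z) * norm (w - z) \<le> e * norm (w - z)"
        by (rule mult_right_mono) simp
      then show ?thesis
        using rem[of w] by (simp add: power2_eq_square inner_commute mult_ac)
    qed
    then show "\<exists>d>0. \<forall>w\<in>UNIV. norm (w - z) < d \<longrightarrow>
        norm (?F w - ?F z - (w - z) \<bullet> p) \<le> e * norm (w - z)"
      using \<open>e > 0\<close> K by (intro exI[of _ "e / K"]) simp
  qed
  moreover have "g = p" if "GDERIV ?F z :> g" for g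
  proof -
    have "(\<lambda>h. h \<bullet> g) = (\<lambda>h. h \<bullet> p)"
      using that der unfolding gderiv_def by (rule has_derivative_unique)
    then show ?thesis by (metis inner_commute vector_eq_ldot)
  qed
  ultimately show ?thesis unfolding grad_def by blast
qed

section \<open>Gradients on a convex set, and squared norms as regularizers\<close>

lemma has_gradient_on_continuous_on:
  "has_gradient_on X f g \<Longrightarrow> continuous_on X f"
  unfolding has_gradient_on_def by (intro has_derivative_continuous_on) blast

lemma has_gradient_on_segment:
  fixes X :: "(real ^ 'n) set"
  assumes "convex X" and g: "has_gradient_on X f g" and x: "x \<in> X" and y: "y \<in> X"
  shows "((\<lambda>t. f (x + t *\<^sub>R (y - x))) has_real_derivative g x \<bullet> (y - x)) (at 0 within {0..1})"
proof -
  let ?p = "\<lambda>t::real. x + t *\<^sub>R (y - x)"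
  have sub: "?p ` {0..1} \<subseteq> X"
  proof clarify
    fix t :: real assume "t \<in> {0..1}"
    then have "(1 - t) *\<^sub>R x + t *\<^sub>R y \<in> X"
      using \<open>convex X\<close> x y by (auto simp: convex_def)
    then show "?p t \<in> X" by (simp add: algebra_simps)
  qed
  have "(f has_derivative (\<lambda>h. g x \<bullet> h)) (at (?p 0) within X)"
    using g x by (simp add: has_gradient_on_def)
  then have "(f has_derivative (\<lambda>h. g x \<bullet> h)) (at (?p 0) within ?p ` {0..1})"
    using sub by (rule has_derivative_subset)
  moreover have "(?p has_derivative (\<lambda>t. t *\<^sub>R (y - x))) (at 0 within {0..1})"
    by (auto intro!: derivative_eq_intros)
  ultimately have "(f \<circ> ?p has_derivative (\<lambda>h. g x \<bullet> h) \<circ> (\<lambda>t. t *\<^sub>R (y - x))) (at 0 within {0..1})"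
    by (rule diff_chain_within[rotated])
  then show ?thesis
    by (simp add: has_field_derivative_def o_def mult_commute_abs)
qed

text \<open>Two gradient fields may differ orthogonally to \<open>X\<close>, but along
  \<open>y - x\<close> both give the one-sided derivative of \<open>f\<close> on the segment from
  \<open>x\<close> to \<open>y\<close>.\<close>

lemma has_gradient_on_unique_inner:
  fixes X :: "(real ^ 'n) set"
  assumes "convex X" "has_gradient_on X f g" "has_gradient_on X f G" "x \<in> X" "y \<in> X"
  shows "g x \<bullet> (y - x) = G x \<bullet> (y - x)"
proof -
  have "(at (0::real) within {0..1}) \<noteq> bot"
    by (simp add: trivial_limit_within)
  then show ?thesis
    using has_gradient_on_segment[OF assms(1,2,4,5)] has_gradient_on_segment[OF assms(1,3,4,5)]
    by (meson vector_derivative_unique_within has_real_derivative_iff_has_vector_derivative)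
qed

text \<open>
  Strong convexity of \<open>\<sigma> / 2 * (N y)\<^sup>2\<close> yields one half of the parallelogram law. Applied to the
  reflection of \<open>x\<close> at \<open>y\<close>, it turns the lower bound on the Bregman divergence into an upper one.
\<close>

lemma regularizer_half_norm_square_upper:
  fixes N :: "real ^ 'n \<Rightarrow> real"
  assumes N: "is_norm N" and "\<sigma> > 0" and G: "regularizer UNIV N \<sigma> (\<lambda>y. \<sigma> / 2 * (N y)\<^sup>2) G"
  shows "\<sigma> / 2 * (N x)\<^sup>2 \<le> \<sigma> / 2 * (N y)\<^sup>2 + G y \<bullet> (x - y) + \<sigma> / 2 * (N (x - y))\<^sup>2"
proof -
  let ?h = "\<lambda>y. \<sigma> / 2 * (N y)\<^sup>2"
  have sc: "strongly_convex_wrt UNIV N \<sigma> ?h G" using G by (simp add: regularizer_def)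
  \<comment> \<open>The points \<open>y\<close> and \<open>x - y\<close> have midpoint
    \<open>x / 2\<close> and difference \<open>x - 2 y\<close> up to sign; homogeneity turns Jensen
    into an inequality between \<open>?h x + ?h (x - y - y)\<close> and
    \<open>2 * ?h y + 2 * ?h (x - y)\<close>.\<close>
  have "?h ((1 - 1/2) *\<^sub>R y + (1/2) *\<^sub>R (x - y))
      \<le> (1 - 1/2) * ?h y + 1/2 * ?h (x - y) - \<sigma> / 2 * (1/2 * (1 - 1/2)) * (N (x - y - y))\<^sup>2"
    by (rule strongly_convex_wrt_Jensen[OF N sc]) auto
  moreover have "(1 - 1/2) *\<^sub>R y + (1/2) *\<^sub>R (x - y) = (1/2) *\<^sub>R x"
    by (simp add: algebra_simps)
  ultimately have "?h x + ?h (x - y - y) \<le> 2 * ?h y + 2 * ?h (x - y)"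
    by (simp add: is_norm_scaleR[OF N] power_mult_distrib power_divide field_simps)
  moreover have "?h y + G y \<bullet> ((y + y - x) - y) + \<sigma> / 2 * (N ((y + y - x) - y))\<^sup>2 \<le> ?h (y + y - x)"
    using sc unfolding strongly_convex_wrt_def by blast
  moreover have "N (y + y - x) = N (x - y - y)" "N (y + y - x - y) = N (x - y)"
    using is_norm_minus_commute[OF N, of "y + y" x] is_norm_minus_commute[OF N, of y x]
    by (simp_all add: diff_diff_eq)
  ultimately show ?thesis by (simp add: inner_diff_right inner_add_right)
qed

text \<open>Since \<psi> agrees with the squared norm on \<open>X\<close>, the global field
  \<open>G\<close> is also a gradient of \<psi> there, and it agrees with \<open>g\<close> in the
  direction \<open>x - y\<close>. The global upper bound therefore transfers.\<close>

lemma bregman_half_norm_square_le: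
  fixes X :: "(real ^ 'n) set"
  assumes N: "is_norm N" and "\<sigma> > 0" and "convex X" and g: "has_gradient_on X \<psi> g"
    and eq: "\<forall>y\<in>X. \<psi> y = \<sigma> / 2 * (N y)\<^sup>2"
    and G: "regularizer UNIV N \<sigma> (\<lambda>y. \<sigma> / 2 * (N y)\<^sup>2) G"
    and x: "x \<in> X" and y: "y \<in> X"
  shows "bregman \<psi> g x y \<le> \<sigma> / 2 * (N (x - y))\<^sup>2"
proof -
  have "has_gradient_on X \<psi> G"
    unfolding has_gradient_on_def
  proof
    fix w assume w: "w \<in> X"
    have "((\<lambda>y. \<sigma> / 2 * (N y)\<^sup>2) has_derivative (\<lambda>h. G w \<bullet> h)) (at w within X)"
      using G by (auto simp: regularizer_def has_gradient_on_def intro: has_derivative_at_withinI)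
    then show "(\<psi> has_derivative (\<lambda>h. G w \<bullet> h)) (at w within X)"
      by (rule has_derivative_transform[OF w, rotated]) (use eq in auto)
  qed
  then have "g y \<bullet> (x - y) = G y \<bullet> (x - y)"
    using has_gradient_on_unique_inner[OF \<open>convex X\<close> g] x y by blast
  then show ?thesis
    using regularizer_half_norm_square_upper[OF N \<open>\<sigma> > 0\<close> G, of x y] eq x y
    by (simp add: bregman_def)
qed

section \<open>Descent of the potential and the general rate\<close>

lemma psum_Suc: "psum a (Suc k) = psum a k + a (Suc k)"
  by (simp add: psum_def)

lemma psum_0: "psum a 0 = 0"
  by (simp add: psum_def)

text \<open>Descent of the potential in one step: \<open>(A + a) * f x'\<close> minus the new
  summand \<open>a * (f x' - gf x' \<bullet> x')\<close> leaves the first two terms on the left, and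
  the earlier summands are common to both sides. The alternative \<open>A = 0\<close> covers the
  dummy starting vector.\<close>

lemma axgd_step:
  fixes X :: "(real ^ 'n) set"
  assumes N: "is_norm N" and "\<sigma> > 0" and "convex X"
    and sc: "strongly_convex_wrt X N \<sigma> \<psi> g"
    and conv: "grad_convex_on X f gf" and smooth: "smooth_wrt X N L gf" and "L > 0"
    and "a > 0" "A \<ge> 0" and ratio: "a\<^sup>2 / (A + a) \<le> \<sigma> / L"
    and x: "A = 0 \<or> x \<in> X" and xh: "xh \<in> X" and x': "x' \<in> X"
    and v: "conjugate_argmax X \<psi> z v" and vh: "conjugate_argmax X \<psi> (z - a *\<^sub>R gf xh) vh"
    and v': "conjugate_argmax X \<psi> (z - a *\<^sub>R gf x') v'"
    and xh_eq: "xh = (A / (A + a)) *\<^sub>R x + (a / (A + a)) *\<^sub>R v"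
    and x'_eq: "x' = (A / (A + a)) *\<^sub>R x + (a / (A + a)) *\<^sub>R vh"
  shows "A * f x' + a * (gf x' \<bullet> x') + conjugate_on X \<psi> (z - a *\<^sub>R gf x')
      \<le> A * f x + conjugate_on X \<psi> z"
proof -
  have X: "vh \<in> X" "v' \<in> X"
    using vh v' by (simp_all add: conjugate_argmax_def)
  have "(A + a) *\<^sub>R x' = A *\<^sub>R x + a *\<^sub>R vh"
    using \<open>a > 0\<close> \<open>A \<ge> 0\<close> by (simp add: x'_eq scaleR_add_right)
  then have "A *\<^sub>R (x' - x) = a *\<^sub>R (vh - x')"
    by (simp add: algebra_simps)
  \<comment> \<open>Turns the convexity estimate for \<open>f x\<close> into a linear term at
    \<open>vh\<close>, which the growth inequalities can absorb.\<close>
  then have comb: "A * (gf x' \<bullet> (x' - x)) = a * (gf x' \<bullet> (vh - x'))"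
    by (metis inner_scaleR_right)
  have "f x' + gf x' \<bullet> (x - x') \<le> f x" if "x \<in> X"
    using conv x' that by (simp add: grad_convex_on_def)
  then have "A * (f x' + gf x' \<bullet> (x - x')) \<le> A * f x"
    using x \<open>A \<ge> 0\<close> by (auto intro: mult_left_mono)
  then have fx: "A * f x' + a * (gf x' \<bullet> x') \<le> A * f x + a * (gf x' \<bullet> vh)"
    using comb by (simp add: inner_diff_right algebra_simps)
  have gh: "(z - a *\<^sub>R gf xh) \<bullet> v' - \<psi> v' + \<sigma> / 2 * (N (v' - vh))\<^sup>2
      \<le> (z - a *\<^sub>R gf xh) \<bullet> vh - \<psi> vh"
    by (rule conjugate_argmax_growth[OF N sc \<open>convex X\<close> vh X(2)])
  have g: "z \<bullet> vh - \<psi> vh + \<sigma> / 2 * (N (vh - v))\<^sup>2 \<le> z \<bullet> v - \<psi> v"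
    by (rule conjugate_argmax_growth[OF N sc \<open>convex X\<close> v X(1)])
  \<comment> \<open>The two averages differ only in the mirror point, so smoothness is measured by
    \<open>N (vh - v)\<close>.\<close>
  have "x' - xh = (a / (A + a)) *\<^sub>R (vh - v)"
    by (simp add: x'_eq xh_eq scaleR_diff_right)
  then have Nx: "N (x' - xh) = a / (A + a) * N (vh - v)"
    using \<open>a > 0\<close> \<open>A \<ge> 0\<close> by (simp add: is_norm_scaleR[OF N])
  have "(gf x' - gf xh) \<bullet> (vh - v') \<le> dual_norm N (gf x' - gf xh) * N (vh - v')"
    by (rule inner_le_dual_norm[OF N])
  also have "\<dots> \<le> (L * N (x' - xh)) * N (vh - v')"
    using smooth x' xh by (intro mult_right_mono is_norm_nonneg[OF N]) (simp add: smooth_wrt_def)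
  finally have "a * ((gf x' - gf xh) \<bullet> (vh - v')) \<le> a * ((L * N (x' - xh)) * N (vh - v'))"
    using \<open>a > 0\<close> by simp
  \<comment> \<open>One factor \<open>a\<close> is the dual step, the other the averaging weight
    \<open>a / (A + a)\<close>; together they form the quotient in the step size condition.\<close>
  also have "\<dots> = (L * (a\<^sup>2 / (A + a))) * (N (vh - v) * N (vh - v'))"
    by (simp add: Nx power2_eq_square)
  also have "\<dots> \<le> \<sigma> * (N (vh - v) * N (vh - v'))"
    using ratio \<open>L > 0\<close>
    by (intro mult_right_mono mult_nonneg_nonneg is_norm_nonneg[OF N]) (simp add: field_simps)
  \<comment> \<open>Young's inequality produces exactly the two growth terms in \<open>g\<close> and
    \<open>gh\<close>.\<close>
  also have "\<dots> \<le> \<sigma> * ((N (vh - v))\<^sup>2 / 2 + (N (vh - v'))\<^sup>2 / 2)"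
    using \<open>\<sigma> > 0\<close> sum_squares_bound[of "N (vh - v)" "N (vh - v')"] by simp
  finally have "a * ((gf x' - gf xh) \<bullet> (vh - v'))
      \<le> \<sigma> / 2 * (N (vh - v))\<^sup>2 + \<sigma> / 2 * (N (v' - vh))\<^sup>2"
    by (simp add: is_norm_minus_commute[OF N, of v' vh] algebra_simps)
  then show ?thesis
    using fx g gh unfolding conjugate_on_eq[OF v] conjugate_on_eq[OF v']
    by (simp add: inner_diff_left inner_diff_right algebra_simps)
qed

text \<open>The potential starts at the conjugate at \<open>z 0\<close>. Its lower bound at
  \<open>xs\<close> contains \<open>z 0 \<bullet> xs - \<psi> xs\<close>, and the gap to the initial
  value is the Bregman divergence.\<close>

lemma axgd_convergence:
  fixes X :: "(real ^ 'n) set"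
  assumes "X \<noteq> {}" and "closed X" and "convex X"
    and N: "is_norm N"
    and "L > 0" and conv: "grad_convex_on X f gf" and smooth: "smooth_wrt X N L gf"
    and xs: "xs \<in> X"
    and "\<sigma> > 0" and reg: "regularizer X N \<sigma> \<psi> g\<psi>"
    and a: "\<forall>k\<ge>1. a k > 0"
    and xh0: "xh 0 \<in> X" and z0: "z 0 = g\<psi> (xh 0)" and alg: "axgd X gf \<psi> a x z xh zh"
    and ratio: "\<forall>k\<ge>1. (a k)\<^sup>2 / psum a k \<le> \<sigma> / L" and "k \<ge> 1"
  shows "f (x k) - f xs \<le> bregman \<psi> g\<psi> xs (xh 0) / psum a k"
proof -
  have sc: "strongly_convex_wrt X N \<sigma> \<psi> g\<psi>" and cont: "continuous_on X \<psi>"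
    using reg has_gradient_on_continuous_on by (auto simp: regularizer_def)
  let ?P = "grad (conjugate_on X \<psi>)"
  have P: "conjugate_argmax X \<psi> w (?P w)" for w
  proof -
    obtain p where p: "conjugate_argmax X \<psi> w p"
      using conjugate_argmax_exists[OF N sc \<open>\<sigma> > 0\<close> \<open>X \<noteq> {}\<close> \<open>closed X\<close> cont] by blast
    then show ?thesis
      using grad_conjugate_on[OF N sc \<open>\<sigma> > 0\<close> \<open>convex X\<close> \<open>closed X\<close> cont p] by simp
  qed
  then have PX: "?P w \<in> X" for w by (simp add: conjugate_argmax_def)
  have aS: "a (Suc k) > 0" for k using a by simp
  have A0: "psum a k \<ge> 0" for k
    by (induction k) (use aS in \<open>simp_all add: psum_0 psum_Suc add_nonneg_pos less_imp_le\<close>)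
  have A: "psum a (Suc k) > 0" for k using A0[of k] aS[of k] by (simp add: psum_Suc)
  have xh: "xh k = (psum a k / psum a (Suc k)) *\<^sub>R x k + (a (Suc k) / psum a (Suc k)) *\<^sub>R ?P (z k)"
    and zh: "zh k = z k - a (Suc k) *\<^sub>R gf (xh k)"
    and xS: "x (Suc k) = (psum a k / psum a (Suc k)) *\<^sub>R x k + (a (Suc k) / psum a (Suc k)) *\<^sub>R ?P (zh k)"
    and zS: "z (Suc k) = z k - a (Suc k) *\<^sub>R gf (x (Suc k))" for k
    using alg by (simp_all add: axgd_def)
  have comb: "(psum a k / psum a (Suc k)) *\<^sub>R u + (a (Suc k) / psum a (Suc k)) *\<^sub>R ?P w \<in> X"
    if "psum a k = 0 \<or> u \<in> X" for u w k
    using that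
  proof
    assume "psum a k = 0"
    then show ?thesis using aS[of k] PX by (simp add: psum_Suc)
  next
    assume "u \<in> X"
    moreover have "psum a k / psum a (Suc k) + a (Suc k) / psum a (Suc k) = 1"
      using A[of k] by (simp add: add_divide_distrib[symmetric] psum_Suc)
    ultimately show ?thesis
      using \<open>convex X\<close> PX[of w] A0[of k] A[of k] aS[of k] unfolding convex_def
      by (meson divide_nonneg_nonneg less_imp_le)
  qed
  \<comment> \<open>The first alternative is needed for \<open>x 0\<close>, which may lie outside
    \<open>X\<close>; the next average then gives weight 1 to a point of \<open>X\<close>.\<close>
  have xX: "psum a k = 0 \<or> x k \<in> X" for k
    by (induction k) (use xS comb in \<open>simp_all add: psum_0\<close>)
  have xSX: "x (Suc k) \<in> X" for k using xX[of "Suc k"] A[of k] by simp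
  have xhX: "xh k \<in> X" for k using comb[OF xX] xh by simp
  \<comment> \<open>With \<open>z 0\<close> the gradient of \<psi> at \<open>xh 0\<close>, strong
    convexity there is the optimality condition.\<close>
  have init: "conjugate_argmax X \<psi> (z 0) (xh 0)"
    unfolding conjugate_argmax_def
  proof (intro conjI ballI)
    fix y assume "y \<in> X"
    then have "\<psi> (xh 0) + z 0 \<bullet> (y - xh 0) + \<sigma> / 2 * (N (y - xh 0))\<^sup>2 \<le> \<psi> y"
      using sc xh0 z0 by (auto simp: strongly_convex_wrt_def)
    moreover have "0 \<le> \<sigma> / 2 * (N (y - xh 0))\<^sup>2" using \<open>\<sigma> > 0\<close> by simp
    ultimately show "z 0 \<bullet> y - \<psi> y \<le> z 0 \<bullet> xh 0 - \<psi> (xh 0)"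
      by (simp add: inner_diff_right)
  qed (rule xh0)
  \<comment> \<open>A weighted sum of the values at the origin of the tangents to \<open>f\<close>
    at the iterates.\<close>
  define S where "S k = (\<Sum>i=1..k. a i * (f (x i) - gf (x i) \<bullet> x i))" for k
  have SS: "S (Suc k) = S k + a (Suc k) * (f (x (Suc k)) - gf (x (Suc k)) \<bullet> x (Suc k))" for k
    by (simp add: S_def)
  have potential: "psum a k * f (x k) - S k + conjugate_on X \<psi> (z k) \<le> z 0 \<bullet> xh 0 - \<psi> (xh 0)" for k
  proof (induction k)
    case 0
    show ?case by (simp add: psum_0 S_def conjugate_on_eq[OF init])
  next
    case (Suc k)
    have "psum a k * f (x (Suc k)) + a (Suc k) * (gf (x (Suc k)) \<bullet> x (Suc k))
        + conjugate_on X \<psi> (z k - a (Suc k) *\<^sub>R gf (x (Suc k)))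
      \<le> psum a k * f (x k) + conjugate_on X \<psi> (z k)"
    proof (rule axgd_step[OF N \<open>\<sigma> > 0\<close> \<open>convex X\<close> sc conv smooth \<open>L > 0\<close> aS A0 _ xX xhX xSX P _ P])
      show "(a (Suc k))\<^sup>2 / (psum a k + a (Suc k)) \<le> \<sigma> / L"
        using ratio by (simp flip: psum_Suc)
      show "conjugate_argmax X \<psi> (z k - a (Suc k) *\<^sub>R gf (xh k)) (?P (zh k))"
        using P[of "zh k"] zh by simp
    qed (use xh xS in \<open>simp_all flip: psum_Suc\<close>)
    then show ?case
      using Suc.IH unfolding SS zS[of k] psum_Suc by (simp add: algebra_simps)
  qed
  \<comment> \<open>The tangent inequalities at \<open>xs\<close>, summed with weights
    \<open>a i\<close>; the weighted gradients add up to \<open>z 0 - z k\<close>.\<close>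
  have lower: "S k + (z 0 - z k) \<bullet> xs \<le> psum a k * f xs" for k
  proof (induction k)
    case 0
    show ?case by (simp add: psum_0 S_def)
  next
    case (Suc k)
    have "f (x (Suc k)) + gf (x (Suc k)) \<bullet> (xs - x (Suc k)) \<le> f xs"
      using conv xSX xs by (auto simp: grad_convex_on_def)
    then have "a (Suc k) * (f (x (Suc k)) + gf (x (Suc k)) \<bullet> (xs - x (Suc k))) \<le> a (Suc k) * f xs"
      using aS[of k] by simp
    then show ?case
      using Suc.IH unfolding SS zS[of k] psum_Suc
      by (simp add: inner_diff_left inner_diff_right algebra_simps)
  qed
  \<comment> \<open>The Fenchel-Young inequality at \<open>xs\<close>.\<close>
  have "z k \<bullet> xs - \<psi> xs \<le> conjugate_on X \<psi> (z k)"
    using P[of "z k"] xs conjugate_on_eq[OF P[of "z k"]] unfolding conjugate_argmax_def by metis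
  then have "psum a k * (f (x k) - f xs) \<le> bregman \<psi> g\<psi> xs (xh 0)"
    using potential[of k] lower[of k]
    by (simp add: bregman_def z0 inner_diff_left inner_diff_right algebra_simps)
  then show ?thesis
    using A[of "k - 1"] \<open>k \<ge> 1\<close> by (simp add: field_simps)
qed

section \<open>The explicit step sizes and the final statement\<close>

lemma psum_arithmetic:
  assumes "\<forall>k\<ge>1. a k = (real k + 1) / 2 * c"
  shows "psum a k = real k * (real k + 3) / 4 * c"
proof (induction k)
  case 0
  show ?case by (simp add: psum_0)
next
  case (Suc k)
  have "a (Suc k) = (real (Suc k) + 1) / 2 * c" using assms by simp
  with Suc show ?case by (simp add: psum_Suc field_simps)
qed

theorem theorem2p5:
  fixes X :: "(real ^ 'n) set"
    and N :: "real ^ 'n \<Rightarrow> real"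
    and f \<psi> :: "real ^ 'n \<Rightarrow> real"
    and gf g\<psi> :: "real ^ 'n \<Rightarrow> real ^ 'n"
    and L \<sigma> :: real
    and a :: "nat \<Rightarrow> real"
    and x z xh zh :: "nat \<Rightarrow> real ^ 'n"
    and xs :: "real ^ 'n"
  assumes "X \<noteq> {}" and "closed X" and "convex X"
    and "is_norm N"
    and "L > 0" and "has_gradient_on X f gf" and "grad_convex_on X f gf" and "smooth_wrt X N L gf"
    and "xs \<in> X" and "\<forall>y\<in>X. f xs \<le> f y"
    and "\<sigma> > 0" and "regularizer X N \<sigma> \<psi> g\<psi>"
    and "\<forall>k\<ge>1. a k > 0"
    and "xh 0 \<in> X" and "z 0 = g\<psi> (xh 0)" and "axgd X gf \<psi> a x z xh zh"
  shows "((\<forall>k\<ge>1. (a k)\<^sup>2 / psum a k \<le> \<sigma> / L) \<longrightarrow>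
            (\<forall>k\<ge>1. f (x k) - f xs \<le> bregman \<psi> g\<psi> xs (xh 0) / psum a k))
       \<and> ((\<forall>k\<ge>1. a k = (real k + 1) / 2 * (\<sigma> / L)) \<and>
          (\<forall>y\<in>X. \<psi> y = \<sigma> / 2 * (N y)\<^sup>2) \<and>
          (\<exists>G. regularizer UNIV N \<sigma> (\<lambda>y. \<sigma> / 2 * (N y)\<^sup>2) G) \<longrightarrow>
            (\<forall>k\<ge>1. f (x k) - f xs \<le> 2 * L / (real k + 1)\<^sup>2 * (N (xs - xh 0))\<^sup>2))"
proof (intro conjI impI)
  assume "\<forall>k\<ge>1. (a k)\<^sup>2 / psum a k \<le> \<sigma> / L"
  then show "\<forall>k\<ge>1. f (x k) - f xs \<le> bregman \<psi> g\<psi> xs (xh 0) / psum a k"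
    using axgd_convergence[OF assms(1-5,7-9,11-16)] by blast
next
  assume special: "(\<forall>k\<ge>1. a k = (real k + 1) / 2 * (\<sigma> / L)) \<and>
      (\<forall>y\<in>X. \<psi> y = \<sigma> / 2 * (N y)\<^sup>2) \<and>
      (\<exists>G. regularizer UNIV N \<sigma> (\<lambda>y. \<sigma> / 2 * (N y)\<^sup>2) G)"
  then have a: "\<forall>k\<ge>1. a k = (real k + 1) / 2 * (\<sigma> / L)" by blast
  have A: "psum a k = real k * (real k + 3) / 4 * (\<sigma> / L)" for k
    by (rule psum_arithmetic[OF a])
  \<comment> \<open>The difference of the two sides is \<open>k - 1\<close>. This inequality gives
    both the step size condition and the passage from \<open>k * (k + 3)\<close> to
    \<open>(k + 1)\<^sup>2\<close> in the rate.\<close>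
  have sq: "(real k + 1)\<^sup>2 \<le> real k * (real k + 3)" if "k \<ge> 1" for k
    using that by (simp add: power2_eq_square algebra_simps)
  have c: "\<sigma> / L > 0" using \<open>\<sigma> > 0\<close> \<open>L > 0\<close> by simp
  have ratio: "\<forall>k\<ge>1. (a k)\<^sup>2 / psum a k \<le> \<sigma> / L"
  proof (intro allI impI)
    fix k :: nat assume k: "k \<ge> 1"
    define c where "c = \<sigma> / L"
    have "c > 0" using c by (simp add: c_def)
    have "(a k)\<^sup>2 = (real k + 1)\<^sup>2 * (c\<^sup>2 / 4)"
      using a[rule_format, OF k] by (simp add: c_def power_mult_distrib power_divide)
    also have "\<dots> \<le> real k * (real k + 3) * (c\<^sup>2 / 4)"
      by (intro mult_right_mono sq k) simp
    also have "\<dots> = c * psum a k"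
      by (simp add: A c_def[symmetric] power2_eq_square)
    finally show "(a k)\<^sup>2 / psum a k \<le> \<sigma> / L"
      using k \<open>c > 0\<close> by (simp add: A c_def[symmetric] pos_divide_le_eq)
  qed
  have breg: "bregman \<psi> g\<psi> xs (xh 0) \<le> \<sigma> / 2 * (N (xs - xh 0))\<^sup>2"
    using special bregman_half_norm_square_le[OF \<open>is_norm N\<close> \<open>\<sigma> > 0\<close> \<open>convex X\<close> _ _ _ \<open>xs \<in> X\<close> \<open>xh 0 \<in> X\<close>]
      \<open>regularizer X N \<sigma> \<psi> g\<psi>\<close> by (auto simp: regularizer_def)
  show "\<forall>k\<ge>1. f (x k) - f xs \<le> 2 * L / (real k + 1)\<^sup>2 * (N (xs - xh 0))\<^sup>2"
  proof (intro allI impI)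
    fix k :: nat assume k: "k \<ge> 1"
    have "f (x k) - f xs \<le> bregman \<psi> g\<psi> xs (xh 0) / psum a k"
      by (rule axgd_convergence[OF assms(1-5,7-9,11-16) ratio k])
    also have "\<dots> \<le> \<sigma> / 2 * (N (xs - xh 0))\<^sup>2 / psum a k"
      using breg \<open>\<sigma> > 0\<close> \<open>L > 0\<close> by (intro divide_right_mono) (simp_all add: A)
    also have "\<dots> = 2 * L / (real k * (real k + 3)) * (N (xs - xh 0))\<^sup>2"
      using \<open>\<sigma> > 0\<close> \<open>L > 0\<close> k by (simp add: A divide_simps)
    also have "\<dots> \<le> 2 * L / (real k + 1)\<^sup>2 * (N (xs - xh 0))\<^sup>2"
    proof (intro mult_right_mono divide_left_mono sq k)
      show "0 < real k * (real k + 3) * (real k + 1)\<^sup>2" using k by simp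
    qed (use \<open>L > 0\<close> in simp_all)
    finally show "f (x k) - f xs \<le> 2 * L / (real k + 1)\<^sup>2 * (N (xs - xh 0))\<^sup>2" .
  qed
qed

end
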